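(* Let $n\ge2$ be an integer. Every Catalan--Stanley tree $\tau$ of size $n$ satisfies $1\le\alpha(\tau)\le\lfloor n/2\rfloor$, and both bounds are attained: there exist Catalan--Stanley trees $\tau,\tau'$ of size $n$ with $\alpha(\tau)=1$ and $\alpha(\tau')=\lfloor n/2\rfloor$. The only tree of size $1$ is the one-node tree, and its age is $0$.
   Context: A rooted plane tree has ordered children at every node; its size is its number of nodes. For each child $c$ of the root, the rightmost leaf of the branch at $c$ is the leaf reached from $c$ by repeatedly moving to the rightmost child. A Catalan--Stanley tree is a rooted plane tree in which every such rightmost leaf has odd distance to the root (the one-node tree is included). The reduction $\rho$: for each rightmost leaf $\ell$ of a branch attached to the root, if $\ell$ is a child of the root it is deleted; otherwise all descendants of the grandparent of $\ell$ are deleted (the grandparent becomes a leaf); the one-node tree is mapped to itself. The age $\alpha(\tau)$ is the least $r\ge0$ such that $\rho^{r}(\tau)$ is the one-node tree. *)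

theory Defs
  imports Main "HOL-Library.Sublist"
begin

datatype plane_tree = Node (children: "plane_tree list")

abbreviation one_node_tree :: plane_tree where
  "one_node_tree \<equiv> Node []"

fun tree_size :: "plane_tree \<Rightarrow> nat" where
  "tree_size (Node ts) = Suc (\<Sum>t\<leftarrow>ts. tree_size t)"

text \<open>
  A node is identified by its address, the list of child indices (from 0, left to right) on the
  path to it from the root. So the root is \<open>[]\<close>, the distance to the root is the length of the
  address, the parent of \<open>p\<close> is \<open>butlast p\<close>, and the descendants of \<open>p\<close> are the nodes whose
  address strictly extends \<open>p\<close>.
\<close>

type_synonym address = "nat list"

lemma size_child: "t \<in> set ts \<Longrightarrow> size t < Suc (size_list size ts)"
  by (induction ts) auto

function rightmost_leaf :: "plane_tree \<Rightarrow> address" where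
  "rightmost_leaf (Node ts) =
     (if ts = [] then [] else (length ts - 1) # rightmost_leaf (last ts))"
  by pat_completeness auto
termination
  by (relation "measure size") (auto intro: size_child)

definition branch_leaves :: "plane_tree \<Rightarrow> address set" where
  "branch_leaves t =
     {i # rightmost_leaf (children t ! i) | i. i < length (children t)}"

definition catalan_stanley :: "plane_tree \<Rightarrow> bool" where
  "catalan_stanley t \<longleftrightarrow> (\<forall>l \<in> branch_leaves t. odd (length l))"

text \<open>
  Deletes the non-root nodes with address in \<open>D\<close>, together with everything below them; addresses
  that are not nodes of the tree have no effect.
\<close>

function delete_nodes :: "address set \<Rightarrow> plane_tree \<Rightarrow> plane_tree" where
  "delete_nodes D (Node ts) =
     Node (map (\<lambda>i. delete_nodes {p. i # p \<in> D} (ts ! i))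
               (filter (\<lambda>i. [i] \<notin> D) [0..<length ts]))"
  by pat_completeness auto
termination
  by (relation "measure (size \<circ> snd)") (auto intro: size_child)

definition deleted_nodes :: "plane_tree \<Rightarrow> address set" where
  "deleted_nodes t =
     {l \<in> branch_leaves t. length l = 1} \<union>
     {p. \<exists>l \<in> branch_leaves t. length l \<noteq> 1 \<and> strict_prefix (butlast (butlast l)) p}"

definition reduction :: "plane_tree \<Rightarrow> plane_tree" where
  "reduction t = delete_nodes (deleted_nodes t) t"

definition age :: "plane_tree \<Rightarrow> nat" where
  "age t = (LEAST r. (reduction ^^ r) t = one_node_tree)"

end

theory Submission
  imports Defs
begin

text \<open>
  In a Catalan--Stanley tree, one reduction removes the branches that consist of a single node and
  shortens the rightmost path of every other branch by exactly two edges. Hence the \<open>r\<close>-fold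
  reduction is the one-node tree iff every branch has a rightmost path of fewer than \<open>2 r\<close> edges,
  and such a path cannot have more nodes than its branch.
\<close>

lemma rightmost_leaf_eq_Nil_iff: "rightmost_leaf t = [] \<longleftrightarrow> t = one_node_tree"
  by (cases t) auto

lemma length_rightmost_leaf_less_tree_size: "length (rightmost_leaf t) < tree_size t"
proof (induction t rule: rightmost_leaf.induct)
  case (1 ts)
  have "tree_size (last ts) \<le> (\<Sum>t\<leftarrow>ts. tree_size t)" if "ts \<noteq> []"
    using that by (intro member_le_sum_list) auto
  with 1 show ?case by auto
qed

text \<open>The edge from the root to the branch adds one to the distance, so odd distance becomes
  even length inside the branch.\<close>

lemma catalan_stanley_iff:
  "catalan_stanley t \<longleftrightarrow> (\<forall>c \<in> set (children t). even (length (rightmost_leaf c)))"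
proof -
  have "catalan_stanley t \<longleftrightarrow>
      (\<forall>i < length (children t). even (length (rightmost_leaf (children t ! i))))"
    unfolding catalan_stanley_def branch_leaves_def by fastforce
  then show ?thesis by (simp only: all_set_conv_all_nth)
qed

text \<open>Induction on \<open>q\<close>: a child address \<open>[j]\<close> cannot strictly extend
  \<open>i # q\<close>, so each node strictly above \<open>q\<close> keeps all its children and the
  index of its last child; at \<open>q\<close> itself all children go.\<close>

lemma rightmost_leaf_delete_below_prefix:
  "rightmost_leaf t = q @ r \<Longrightarrow> rightmost_leaf (delete_nodes {p. strict_prefix q p} t) = q"
proof (induction q arbitrary: t)
  case Nil
  show ?case by (cases t) (simp add: filter_empty_conv)
next
  case (Cons i q)
  obtain ts where t: "t = Node ts" by (cases t)
  with Cons.prems have ts: "ts \<noteq> []" and i: "i = length ts - 1"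
    and last: "rightmost_leaf (last ts) = q @ r"
    by (auto split: if_splits)
  have "filter (\<lambda>j. [j] \<notin> {p. strict_prefix (i # q) p}) [0..<length ts] = [0..<length ts]"
    by (auto simp: filter_id_conv strict_prefix_def)
  moreover have "{p. i # p \<in> {p. strict_prefix (i # q) p}} = {p. strict_prefix q p}"
    by auto
  ultimately show ?case
    using Cons.IH[OF last] ts i by (simp add: t last_map last_conv_nth)
qed

text \<open>This is the effect of \<open>reduction\<close> on a branch with more than one node of a
  Catalan--Stanley tree, with addresses relative to the branch.\<close>

definition prune :: "plane_tree \<Rightarrow> plane_tree" where
  "prune c = delete_nodes {p. strict_prefix (butlast (butlast (rightmost_leaf c))) p} c"

text \<open>Truncated subtraction agrees with \<open>butlast []\<close> being
  \<open>[]\<close>.\<close>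

lemma length_rightmost_leaf_prune:
  "length (rightmost_leaf (prune c)) = length (rightmost_leaf c) - 2"
proof -
  let ?l = "rightmost_leaf c"
  have "?l = butlast (butlast ?l) @ drop (length ?l - 2) ?l"
    by (simp add: butlast_conv_take min_def numeral_2_eq_2)
  then have "rightmost_leaf (prune c) = butlast (butlast ?l)"
    unfolding prune_def by (rule rightmost_leaf_delete_below_prefix)
  then show ?thesis by simp
qed

text \<open>Turns the selection by indices in \<open>delete_nodes\<close> into a selection of
  branches.\<close>

lemma map_filter_upt_nth:
  "map (\<lambda>i. f (xs ! i)) (filter (\<lambda>i. P (xs ! i)) [0..<length xs]) = map f (filter P xs)"
proof -
  have "filter P xs = map ((!) xs) (filter (P \<circ> (!) xs) [0..<length xs])"
    by (metis filter_map map_nth)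
  then show ?thesis by (simp add: comp_def)
qed

text \<open>Every deleted address begins with the index of the branch that causes the deletion, so
  the branches are treated independently.\<close>

lemma reduction_catalan_stanley:
  assumes "catalan_stanley (Node ts)"
  shows "reduction (Node ts) = Node (map prune (filter (\<lambda>c. c \<noteq> one_node_tree) ts))"
proof -
  let ?D = "deleted_nodes (Node ts)" and ?rl = "\<lambda>i. rightmost_leaf (ts ! i)"
  have ev: "even (length (?rl i))" if "i < length ts" for i
    using assms that by (simp add: catalan_stanley_iff)
  \<comment> \<open>Parity puts the grandparent of a rightmost leaf strictly below the root, so that no other
    branch is affected.\<close>
  have bb: "butlast (butlast (i # ?rl i)) = i # butlast (butlast (?rl i))"
    if "i < length ts" "ts ! i \<noteq> one_node_tree" for i
  proof -
    have "?rl i \<noteq> []" using that by (simp add: rightmost_leaf_eq_Nil_iff)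
    moreover have "butlast (?rl i) \<noteq> []"
      using ev[OF that(1)] \<open>?rl i \<noteq> []\<close> by (cases "?rl i") auto
    ultimately show ?thesis by simp
  qed
  have D: "p \<in> ?D \<longleftrightarrow> (\<exists>i < length ts. if ts ! i = one_node_tree then p = [i]
      else strict_prefix (i # butlast (butlast (?rl i))) p)" for p
  proof -
    have "p \<in> ?D \<longleftrightarrow> (\<exists>i < length ts. if ts ! i = one_node_tree then p = [i]
        else strict_prefix (butlast (butlast (i # ?rl i))) p)"
      unfolding deleted_nodes_def branch_leaves_def
      by (auto simp: rightmost_leaf_eq_Nil_iff split: if_splits)
    also have "\<dots> \<longleftrightarrow> (\<exists>i < length ts. if ts ! i = one_node_tree then p = [i]
        else strict_prefix (i # butlast (butlast (?rl i))) p)"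
      using bb by metis
    finally show ?thesis .
  qed
  \<comment> \<open>A strict extension of an address starting with \<open>i\<close> has at least two
    entries, so a child of the root is deleted only as a one-node branch.\<close>
  have child: "[i] \<notin> ?D \<longleftrightarrow> ts ! i \<noteq> one_node_tree" if "i < length ts" for i
    using that by (auto simp: D strict_prefix_def)
  have below: "{p. i # p \<in> ?D} = {p. strict_prefix (butlast (butlast (?rl i))) p}"
    if "i < length ts" "ts ! i \<noteq> one_node_tree" for i
    using that by (auto simp: D split: if_splits)
  have "filter (\<lambda>i. [i] \<notin> ?D) [0..<length ts]
      = filter (\<lambda>i. ts ! i \<noteq> one_node_tree) [0..<length ts]"
    using child by (intro filter_cong) auto
  then have "reduction (Node ts) = Node (map (\<lambda>i. prune (ts ! i))
      (filter (\<lambda>i. ts ! i \<noteq> one_node_tree) [0..<length ts]))"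
    using below by (auto simp: reduction_def prune_def)
  then show ?thesis
    by (simp only: map_filter_upt_nth[of prune ts "\<lambda>c. c \<noteq> one_node_tree"])
qed

lemma catalan_stanley_reduction:
  "catalan_stanley t \<Longrightarrow> catalan_stanley (reduction t)"
  by (cases t)
    (auto simp: reduction_catalan_stanley catalan_stanley_iff length_rightmost_leaf_prune)

text \<open>Each round takes two edges off a rightmost path, and one further round removes a branch
  that has become a single node; hence the strict inequality.\<close>

lemma funpow_reduction_eq_one_node_iff:
  "catalan_stanley t \<Longrightarrow>
     (reduction ^^ r) t = one_node_tree \<longleftrightarrow>
     (\<forall>c \<in> set (children t). length (rightmost_leaf c) < 2 * r)"
proof (induction r arbitrary: t)
  case 0
  show ?case by (cases t) simp
next
  case (Suc r)
  obtain ts where t: "t = Node ts" by (cases t)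
  \<comment> \<open>Parity gives at least two edges in a branch with more than one node, so the
    subtraction does not truncate.\<close>
  have step: "(c \<noteq> one_node_tree \<longrightarrow> length (rightmost_leaf c) - 2 < 2 * r) \<longleftrightarrow>
      length (rightmost_leaf c) < 2 * Suc r" if "c \<in> set ts" for c
  proof (cases "c = one_node_tree")
    case False
    then have "length (rightmost_leaf c) \<noteq> 0"
      by (simp add: rightmost_leaf_eq_Nil_iff)
    moreover have "even (length (rightmost_leaf c))"
      using Suc.prems that by (simp add: t catalan_stanley_iff)
    ultimately have "length (rightmost_leaf c) \<ge> 2"
      by presburger
    with False show ?thesis by auto
  qed auto
  have "(reduction ^^ Suc r) t = one_node_tree \<longleftrightarrow>
      (\<forall>c \<in> set (children (reduction t)). length (rightmost_leaf c) < 2 * r)"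
    using Suc.IH[OF catalan_stanley_reduction[OF Suc.prems]] by (simp add: funpow_swap1)
  also have "\<dots> \<longleftrightarrow>
      (\<forall>c \<in> set ts. c \<noteq> one_node_tree \<longrightarrow> length (rightmost_leaf c) - 2 < 2 * r)"
    using Suc.prems by (auto simp: t reduction_catalan_stanley length_rightmost_leaf_prune)
  also have "\<dots> \<longleftrightarrow> (\<forall>c \<in> set (children t). length (rightmost_leaf c) < 2 * Suc r)"
    using step by (simp add: t)
  finally show ?case .
qed

lemma age_catalan_stanley:
  "catalan_stanley t \<Longrightarrow>
     age t = (LEAST r. \<forall>c \<in> set (children t). length (rightmost_leaf c) < 2 * r)"
  by (simp add: age_def funpow_reduction_eq_one_node_iff)

text \<open>A path with \<open>k\<close> edges in a branch uses \<open>k + 1\<close> nodes, and the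
  root is one more. This makes \<open>tree_size t div 2\<close> a candidate for the
  \<open>LEAST\<close> that defines the age.\<close>

lemma length_rightmost_leaf_child_bound:
  assumes "c \<in> set (children t)"
  shows "length (rightmost_leaf c) < 2 * (tree_size t div 2)"
proof -
  obtain ts where t: "t = Node ts" by (cases t)
  have "tree_size c \<le> (\<Sum>t\<leftarrow>ts. tree_size t)"
    using assms by (intro member_le_sum_list) (auto simp: t)
  then have "length (rightmost_leaf c) + 2 \<le> tree_size t"
    using length_rightmost_leaf_less_tree_size[of c] by (simp add: t)
  then show ?thesis by presburger
qed

lemma age_le_half_tree_size:
  assumes "catalan_stanley t"
  shows "age t \<le> tree_size t div 2"
  unfolding age_catalan_stanley[OF assms]
  by (rule Least_le) (blast intro: length_rightmost_leaf_child_bound)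

lemma length_rightmost_leaf_less_age:
  assumes "catalan_stanley t" "c \<in> set (children t)"
  shows "length (rightmost_leaf c) < 2 * age t"
proof -
  have "\<forall>c \<in> set (children t). length (rightmost_leaf c) < 2 * age t"
    unfolding age_catalan_stanley[OF assms(1)]
    \<comment> \<open>The least value has the property only because some value has it; half the size
      serves as witness.\<close>
    by (rule LeastI[of _ "tree_size t div 2"]) (blast intro: length_rightmost_leaf_child_bound)
  with assms(2) show ?thesis by blast
qed

lemma age_pos:
  assumes "catalan_stanley t" "tree_size t \<ge> 2"
  shows "age t \<ge> 1"
proof -
  have "children t \<noteq> []"
    using assms(2) by (cases t) auto
  then obtain c where "c \<in> set (children t)"
    by (meson last_in_set)
  then show ?thesis
    using length_rightmost_leaf_less_age[OF assms(1)] by fastforce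
qed

lemma ex_catalan_stanley_age_1:
  assumes "n \<ge> 2"
  shows "\<exists>t. catalan_stanley t \<and> tree_size t = n \<and> age t = 1"
proof (intro exI conjI)
  \<comment> \<open>In a star all branches are single nodes and vanish in one round.\<close>
  let ?t = "Node (replicate (n - 1) one_node_tree)"
  show cs: "catalan_stanley ?t" by (simp add: catalan_stanley_iff)
  show size: "tree_size ?t = n" using assms by (simp add: sum_list_replicate)
  have "age ?t \<le> 1"
    unfolding age_catalan_stanley[OF cs] by (rule Least_le) simp
  with age_pos[OF cs] size assms show "age ?t = 1" by simp
qed

primrec path_tree :: "nat \<Rightarrow> plane_tree" where
  "path_tree 0 = one_node_tree"
| "path_tree (Suc k) = Node [path_tree k]"

lemma tree_size_path_tree: "tree_size (path_tree k) = Suc k"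
  by (induction k) auto

lemma length_rightmost_leaf_path_tree: "length (rightmost_leaf (path_tree k)) = k"
  by (induction k) auto

lemma ex_catalan_stanley_age_half:
  assumes "n \<ge> 2"
  shows "\<exists>t. catalan_stanley t \<and> tree_size t = n \<and> age t = n div 2"
proof (intro exI conjI)
  \<comment> \<open>The root and a path branch with \<open>?k\<close> edges have
    \<open>2 * (n div 2)\<close> nodes together; for odd \<open>n\<close> one extra leaf at the root
    completes the size.\<close>
  let ?k = "2 * (n div 2 - 1)"
  let ?t = "Node (path_tree ?k # replicate (n mod 2) one_node_tree)"
  show cs: "catalan_stanley ?t"
    by (simp add: catalan_stanley_iff length_rightmost_leaf_path_tree)
  have "?k + 2 + n mod 2 = n" using assms by presburger
  then show size: "tree_size ?t = n"
    by (simp add: sum_list_replicate tree_size_path_tree)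
  \<comment> \<open>By the choice of \<open>?k\<close>, this says that the age exceeds
    \<open>n div 2 - 1\<close>.\<close>
  have "?k < 2 * age ?t"
    using length_rightmost_leaf_less_age[OF cs, of "path_tree ?k"]
    by (simp add: length_rightmost_leaf_path_tree)
  moreover have "age ?t \<le> n div 2"
    using age_le_half_tree_size[OF cs] size by simp
  ultimately show "age ?t = n div 2" by linarith
qed

lemma tree_size_eq_1_iff: "tree_size t = 1 \<longleftrightarrow> t = one_node_tree"
proof (cases t)
  case (Node ts)
  then show ?thesis
    \<comment> \<open>Splitting \<open>hd ts\<close> shows that a first child contributes at least
      one node.\<close>
    by (cases ts; cases "hd ts") auto
qed

lemma age_one_node_tree: "age one_node_tree = 0"
  unfolding age_def by (rule Least_eq_0) simp

theorem mainTheorem7: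
  shows "(\<forall>n::nat. n \<ge> 2 \<longrightarrow>
            (\<forall>t. catalan_stanley t \<and> tree_size t = n \<longrightarrow> 1 \<le> age t \<and> age t \<le> n div 2) \<and>
            (\<exists>t. catalan_stanley t \<and> tree_size t = n \<and> age t = 1) \<and>
            (\<exists>t'. catalan_stanley t' \<and> tree_size t' = n \<and> age t' = n div 2)) \<and>
         {t. tree_size t = 1} = {one_node_tree} \<and>
         age one_node_tree = 0"
proof (intro conjI allI impI)
  fix n :: nat
  assume n: "n \<ge> 2"
  show "\<exists>t. catalan_stanley t \<and> tree_size t = n \<and> age t = 1"
    by (rule ex_catalan_stanley_age_1[OF n])
  show "\<exists>t'. catalan_stanley t' \<and> tree_size t' = n \<and> age t' = n div 2"
    by (rule ex_catalan_stanley_age_half[OF n])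
  fix t
  assume t: "catalan_stanley t \<and> tree_size t = n"
  show "1 \<le> age t" using age_pos[of t] t n by blast
  show "age t \<le> n div 2" using age_le_half_tree_size[of t] t by blast
next
  show "{t. tree_size t = 1} = {one_node_tree}"
    by (simp only: tree_size_eq_1_iff singleton_conv)
qed (rule age_one_node_tree)

end
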